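(* A sequence of order $2$ with terms from $\{\mathtt{A^*},\mathtt{A^+},\mathtt{A^-},\mathtt{N},\mathtt{S^*},\mathtt{S^+},\mathtt{S^-}\}$ does not occur as a subsequence of the sepr-sequence of any real symmetric matrix if and only if it is one of the following sequences: $\mathtt{A^*N}$, $\mathtt{NA^*}$, $\mathtt{NS^*}$, $\mathtt{S^*N}$.
   Context: Let $B$ be an $n\times n$ real symmetric matrix ($n$ any positive integer). For $\alpha\subseteq\{1,\dots,n\}$ with $|\alpha|=k\ge 1$, the determinant of the submatrix $B[\alpha]$ lying in the rows and columns indexed by $\alpha$ is a principal minor of order $k$. The signed enhanced principal rank characteristic sequence (sepr-sequence) of $B$ is $\operatorname{sepr}(B)=t_1t_2\cdots t_n$, where each $t_k$ is one of the seven symbols $\mathtt{A^*},\mathtt{A^+},\mathtt{A^-},\mathtt{N},\mathtt{S^*},\mathtt{S^+},\mathtt{S^-}$, determined as follows: - $t_k=\mathtt{A^*}$ if all order-$k$ principal minors of $B$ are nonzero and there are both positive and negative ones; - $t_k=\mathtt{A^+}$ (respectively $\mathtt{A^-}$) if all order-$k$ principal minors of $B$ are positive (respectively negative); - $t_k=\mathtt{N}$ if all order-$k$ principal minors of $B$ are zero; - $t_k=\mathtt{S^*}$ if $B$ has a positive, a negative and a zero order-$k$ principal minor; - $t_k=\mathtt{S^+}$ (respectively $\mathtt{S^-}$) if $B$ has both a zero and a nonzero order-$k$ principal minor and all nonzero order-$k$ principal minors are positive (respectively negative). The order of a sequence is its number of terms. A subsequence of $x_1x_2\cdots x_n$ means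 a block of consecutive terms $x_px_{p+1}\cdots x_q$ with $1\le p\le q\le n$. *)

theory Defs
  imports
    Complex_Main
    "HOL-Library.Sublist"
    "Jordan_Normal_Form.Determinant"
    "Jordan_Normal_Form.DL_Submatrix"
begin

datatype sepr_symbol = Astar | Aplus | Aminus | N | Sstar | Splus | Sminus

text \<open>A matrix equal to its transpose is necessarily square.\<close>

definition symmetric_mat :: "'a mat \<Rightarrow> bool" where
  "symmetric_mat B \<longleftrightarrow> transpose_mat B = B"

text \<open>Matrix indices start at 0, so the index sets are the subsets of \<open>{..<n}\<close>.\<close>

definition principal_minors :: "real mat \<Rightarrow> nat \<Rightarrow> real set" where
  "principal_minors B k =
     (\<lambda>\<alpha>. det (submatrix B \<alpha> \<alpha>)) ` {\<alpha>. \<alpha> \<subseteq> {..<dim_row B} \<and> card \<alpha> = k}"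

text \<open>
  Used only for \<open>1 \<le> k \<le> dim_row B\<close>, where there is at least one minor of order \<open>k\<close>; the
  conditions are then exhaustive and mutually exclusive, and the last branch is exactly the
  defining condition of \<open>S\<^sup>-\<close> (see \<open>sepr_term_eq_Sminus_iff\<close>).
\<close>

definition sepr_term :: "real mat \<Rightarrow> nat \<Rightarrow> sepr_symbol" where
  "sepr_term B k = (let M = principal_minors B k in
     if (\<forall>x\<in>M. x \<noteq> 0) \<and> (\<exists>x\<in>M. x > 0) \<and> (\<exists>x\<in>M. x < 0) then Astar
     else if \<forall>x\<in>M. x > 0 then Aplus
     else if \<forall>x\<in>M. x < 0 then Aminus
     else if \<forall>x\<in>M. x = 0 then N
     else if (\<exists>x\<in>M. x > 0) \<and> (\<exists>x\<in>M. x < 0) \<and> (\<exists>x\<in>M. x = 0) then Sstar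
     else if (\<exists>x\<in>M. x = 0) \<and> (\<exists>x\<in>M. x \<noteq> 0) \<and> (\<forall>x\<in>M. x \<noteq> 0 \<longrightarrow> x > 0) then Splus
     else Sminus)"

text \<open>The list position \<open>i\<close> (from 0) of \<open>sepr B\<close> holds the term of order \<open>i + 1\<close>.\<close>

definition sepr :: "real mat \<Rightarrow> sepr_symbol list" where
  "sepr B = map (sepr_term B) [1..<Suc (dim_row B)]"

lemma principal_minors_nonempty:
  assumes "k \<le> dim_row B"
  shows "principal_minors B k \<noteq> {}"
proof -
  have "{..<k} \<subseteq> {..<dim_row B} \<and> card {..<k} = k"
    using assms by auto
  then show ?thesis
    unfolding principal_minors_def by blast
qed

lemma sepr_term_eq_Sminus_iff:
  assumes "k \<le> dim_row B"
  defines "M \<equiv> principal_minors B k"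
  shows "sepr_term B k = Sminus \<longleftrightarrow>
    (\<exists>x\<in>M. x = 0) \<and> (\<exists>x\<in>M. x \<noteq> 0) \<and> (\<forall>x\<in>M. x \<noteq> 0 \<longrightarrow> x < 0)"
proof -
  obtain m where "m \<in> M"
    using principal_minors_nonempty[OF assms(1)] unfolding M_def by blast
  define p q z where "p = (\<exists>x\<in>M. x > 0)" and "q = (\<exists>x\<in>M. x < 0)" and "z = (\<exists>x\<in>M. x = 0)"
  have "p \<or> q \<or> z"
    unfolding p_def q_def z_def using \<open>m \<in> M\<close> linorder_neqE_linordered_idom by blast
  moreover have "(\<exists>x\<in>M. x > 0) = p" "(\<exists>x\<in>M. x < 0) = q" "(\<exists>x\<in>M. x = 0) = z"
    by (simp_all only: p_def q_def z_def)
  moreover have "(\<forall>x\<in>M. x \<noteq> 0) = (\<not> z)" "(\<exists>x\<in>M. x \<noteq> 0) = (p \<or> q)"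
    "(\<forall>x\<in>M. x > 0) = (\<not> q \<and> \<not> z)" "(\<forall>x\<in>M. x < 0) = (\<not> p \<and> \<not> z)"
    "(\<forall>x\<in>M. x = 0) = (\<not> p \<and> \<not> q)"
    "(\<forall>x\<in>M. x \<noteq> 0 \<longrightarrow> x > 0) = (\<not> q)" "(\<forall>x\<in>M. x \<noteq> 0 \<longrightarrow> x < 0) = (\<not> p)"
    unfolding p_def q_def z_def
    by (metis less_asym less_irrefl linorder_cases)+
  ultimately show ?thesis
    unfolding sepr_term_def Let_def M_def[symmetric]
    by (simp only:) auto
qed

end

theory Submission
  imports Defs
begin

text \<open>
  Call an index set \<open>\<gamma>\<close> feasible if the principal minor \<open>det B[\<gamma>]\<close> is nonzero. The exclusion
  of the four pairs amounts to one claim: when every minor of order \<open>k + 1\<close> vanishes, the nonzero minors of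
  order \<open>k\<close> have one sign, and so do those of order \<open>k + 2\<close>.

  The reason is that the feasible sets of a symmetric matrix satisfy an exchange axiom which also
  controls signs (\<open>symmetric_exchange\<close>). For \<open>\<gamma>\<close> feasible, principal pivoting gives a matrix \<open>A\<close> with
  \<open>det B[\<gamma> \<triangle> \<beta>] = det B[\<gamma>] * det A[\<beta>]\<close> for all \<open>\<beta>\<close>, where \<open>A\<close> is symmetric up to a sign change in the
  positions \<open>(x, y)\<close> with exactly one of \<open>x\<close> and \<open>y\<close> in \<open>\<gamma>\<close>
  (\<open>principal_pivot_transform\<close>). If \<open>\<delta>\<close> is feasible as well, then \<open>A[\<gamma> \<triangle> \<delta>]\<close> is nonsingular, so its
  row \<open>x\<close> contains a nonzero entry \<open>A\<^sub>x\<^sub>y\<close>. If moreover \<open>\<gamma> \<triangle> {x}\<close> is not feasible, then \<open>A\<^sub>x\<^sub>x = 0\<close>, and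
  \<open>det A[{x, y}] = - A\<^sub>x\<^sub>y * A\<^sub>y\<^sub>x = \<plusminus> A\<^sub>x\<^sub>y\<^sup>2\<close>. Hence \<open>\<gamma> \<triangle> {x, y}\<close> is feasible, its minor has the sign
  of \<open>det B[\<gamma>]\<close> if both sets have the same size, and the opposite sign if the sizes differ by two.

  If no set of size \<open>k + 1\<close> is feasible, such steps lead from any feasible set of size \<open>k\<close> or \<open>k + 2\<close>
  to any other one through feasible sets of these two sizes. So all feasible sets of
  size \<open>k\<close> share one sign, and all those of size \<open>k + 2\<close> share the opposite one
  (\<open>signed_minors_agree\<close>).

  The remaining 45 pairs occur in the sequences of 18 explicit integer matrices of order 3 or 4,
  whose minors are evaluated by Laplace expansion.
\<close>

section \<open>Determinants of principal submatrices\<close>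

abbreviation principal_minor :: "'a :: comm_ring_1 mat \<Rightarrow> nat set \<Rightarrow> 'a" where
  "principal_minor B \<alpha> \<equiv> det (submatrix B \<alpha> \<alpha>)"

text \<open>
  The Leibniz formula with permutations of \<open>\<alpha>\<close> itself instead of the positions \<open>0, \<dots>, card \<alpha> - 1\<close> of
  its elements. It makes minors for different index sets comparable without renumbering.
\<close>

lemma det_submatrix_eq_sum_permutes:
  fixes A :: "'a :: comm_ring_1 mat"
  assumes A: "A \<in> carrier_mat n n" and sub: "\<alpha> \<subseteq> {..<n}"
  shows "principal_minor A \<alpha> = (\<Sum>p | p permutes \<alpha>. of_int (sign p) * (\<Prod>i\<in>\<alpha>. A $$ (i, p i)))"
proof -
  define k where "k = card \<alpha>"
  have fin: "finite \<alpha>" using sub finite_subset by blast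
  have card_eq: "{i. i < n \<and> i \<in> \<alpha>} = \<alpha>" using sub by auto
  have sub_eq: "submatrix A \<alpha> \<alpha> = mat k k (\<lambda>(i, j). A $$ (pick \<alpha> i, pick \<alpha> j))"
    using A card_eq by (simp add: submatrix_def k_def)
  have bij: "bij_betw (pick \<alpha>) {0..<k} \<alpha>"
  proof (rule bij_betw_imageI)
    show "inj_on (pick \<alpha>) {0..<k}"
      unfolding k_def by (rule inj_onI) (metis atLeastLessThan_iff card_pick)
    then have "card (pick \<alpha> ` {0..<k}) = card \<alpha>"
      by (simp add: card_image k_def)
    moreover have "pick \<alpha> ` {0..<k} \<subseteq> \<alpha>"
      using pick_in_set by (auto simp: k_def)
    ultimately show "pick \<alpha> ` {0..<k} = \<alpha>"
      using fin card_subset_eq by blast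
  qed
  \<comment> \<open>conjugation by the increasing enumeration of \<open>\<alpha>\<close> matches the permutations and keeps their signs\<close>
  let ?to = "map_permutation {0..<k} (pick \<alpha>)"
  let ?from = "map_permutation \<alpha> (inv_into {0..<k} (pick \<alpha>))"
  have inj: "inj_on (pick \<alpha>) {0..<k}" and img: "pick \<alpha> ` {0..<k} = \<alpha>"
    using bij by (auto simp: bij_betw_def)
  have "principal_minor A \<alpha> =
      (\<Sum>p | p permutes {0..<k}. of_int (sign p) * (\<Prod>i = 0..<k. A $$ (pick \<alpha> i, pick \<alpha> (p i))))"
    unfolding sub_eq det_def
    by (auto intro!: sum.cong arg_cong2[where f = times] prod.cong simp: permutes_in_image[of _ "{0..<k}", simplified])
  also have "\<dots> = (\<Sum>p | p permutes \<alpha>. of_int (sign p) * (\<Prod>i\<in>\<alpha>. A $$ (i, p i)))"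
  proof (rule sum.reindex_bij_witness[where i = ?from and j = ?to], goal_cases)
    case (1 p)
    have eq: "(inv_into {0..<k} (pick \<alpha>) \<circ> pick \<alpha>) r = id r" if "r \<in> {0..<k}" for r
      using inj that by simp
    have "?from (?to p) = map_permutation {0..<k} (inv_into {0..<k} (pick \<alpha>) \<circ> pick \<alpha>) p"
      using 1 inj img bij by (intro map_permutation_compose inj_on_inv_into) auto
    also have "\<dots> = map_permutation {0..<k} id p"
      using 1 by (intro map_permutation_cong eq inj_onI) (simp_all only: eq id_apply mem_Collect_eq)
    finally show ?case using 1 by simp
  next
    case (2 p)
    then show ?case using bij map_permutation_permutes by auto
  next
    case (3 p)
    have eq: "(pick \<alpha> \<circ> inv_into {0..<k} (pick \<alpha>)) r = id r" if "r \<in> \<alpha>" for r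
      using f_inv_into_f[of r "pick \<alpha>" "{0..<k}"] img that by simp
    have "?to (?from p) = map_permutation \<alpha> (pick \<alpha> \<circ> inv_into {0..<k} (pick \<alpha>)) p"
      using 3 inj img bij bij_betw_inv_into[OF bij]
      by (intro map_permutation_compose) auto
    also have "\<dots> = map_permutation \<alpha> id p"
      using 3 by (intro map_permutation_cong eq inj_onI) (simp_all only: eq id_apply mem_Collect_eq)
    finally show ?case using 3 by simp
  next
    case (4 p)
    then show ?case using bij_betw_inv_into[OF bij] map_permutation_permutes by auto
  next
    case (5 p)
    have "(\<Prod>i\<in>\<alpha>. A $$ (i, ?to p i)) = (\<Prod>i = 0..<k. A $$ (pick \<alpha> i, ?to p (pick \<alpha> i)))"
      by (rule prod.reindex_bij_betw[OF bij, symmetric])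
    also have "\<dots> = (\<Prod>i = 0..<k. A $$ (pick \<alpha> i, pick \<alpha> (p i)))"
      by (intro prod.cong refl) (simp add: map_permutation_apply[OF inj])
    finally have "(\<Prod>i\<in>\<alpha>. A $$ (i, ?to p i)) = (\<Prod>i = 0..<k. A $$ (pick \<alpha> i, pick \<alpha> (p i)))" .
    moreover have "sign (?to p) = sign p"
      using 5 by (intro sign_map_permutation inj) auto
    ultimately show ?case by simp
  qed
  finally show ?thesis .
qed

text \<open>
  For \<open>Y\<close> the identity matrix, this is a selection of columns of \<open>[X | I]\<close>, one from each pair of
  corresponding columns.
\<close>

definition mix_cols :: "nat set \<Rightarrow> 'a mat \<Rightarrow> 'a mat \<Rightarrow> 'a mat" where
  "mix_cols \<beta> X Y = mat (dim_row X) (dim_col X) (\<lambda>(i, j). if j \<in> \<beta> then X $$ (i, j) else Y $$ (i, j))"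

lemma mix_cols_carrier [simp]: "X \<in> carrier_mat n m \<Longrightarrow> mix_cols \<beta> X Y \<in> carrier_mat n m"
  by (auto simp: mix_cols_def)

lemma index_mix_cols [simp]:
  "X \<in> carrier_mat n m \<Longrightarrow> i < n \<Longrightarrow> j < m \<Longrightarrow>
    mix_cols \<beta> X Y $$ (i, j) = (if j \<in> \<beta> then X $$ (i, j) else Y $$ (i, j))"
  by (auto simp: mix_cols_def)

text \<open>
  A column outside \<open>\<beta>\<close> is a unit vector, so only the permutations that fix every index outside \<open>\<beta>\<close>
  contribute to the determinant. All principal minors thus become determinants of the same size,
  and ratios of them can be computed by matrix products.
\<close>

lemma det_mix_cols_one:
  fixes A :: "'a :: comm_ring_1 mat"
  assumes A: "A \<in> carrier_mat n n" and sub: "\<beta> \<subseteq> {..<n}"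
  shows "det (mix_cols \<beta> A (1\<^sub>m n)) = principal_minor A \<beta>"
proof -
  let ?M = "mix_cols \<beta> A (1\<^sub>m n)"
  have "det ?M = (\<Sum>p | p permutes {0..<n}. of_int (sign p) * (\<Prod>i = 0..<n. ?M $$ (i, p i)))"
    using A by (subst det_def'[where n = n]) auto
  also have "\<dots> = (\<Sum>p | p permutes \<beta>. of_int (sign p) * (\<Prod>i = 0..<n. ?M $$ (i, p i)))"
  proof (rule sum.mono_neutral_right)
    show "finite {p. p permutes {0..<n}}" by (simp add: finite_permutations)
    show "{p. p permutes \<beta>} \<subseteq> {p. p permutes {0..<n}}"
      using sub permutes_subset[of _ \<beta> "{0..<n}"] by (auto simp: atLeast0LessThan)
    show "\<forall>p\<in>{p. p permutes {0..<n}} - {p. p permutes \<beta>}.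
        of_int (sign p) * (\<Prod>i = 0..<n. ?M $$ (i, p i)) = 0"
    proof
      fix p assume "p \<in> {p. p permutes {0..<n}} - {p. p permutes \<beta>}"
      then have p: "p permutes {0..<n}" and np: "\<not> p permutes \<beta>" by auto
      \<comment> \<open>some \<open>j\<close> outside \<open>\<beta>\<close> is moved; its preimage \<open>i \<noteq> j\<close> meets the zero entry \<open>(i, j)\<close> of the identity\<close>
      obtain j where j: "j \<notin> \<beta>" "p j \<noteq> j" "j < n"
      proof -
        have "\<not> (\<forall>j\<in>{0..<n} - \<beta>. p j = j)"
          using permutes_superset[OF p] np by blast
        then show ?thesis using that by auto
      qed
      obtain i where "p i = j"
        using permutes_surj[OF p] by (metis surjD)
      then have i: "p i = j" "i < n" "i \<noteq> j"
        using j permutes_in_image[OF p, of i] by auto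
      have "?M $$ (i, p i) = 0" using A i j by simp
      then have "(\<Prod>i = 0..<n. ?M $$ (i, p i)) = 0"
        using i by (intro prod_zero) auto
      then show "of_int (sign p) * (\<Prod>i = 0..<n. ?M $$ (i, p i)) = 0" by simp
    qed
  qed
  also have "\<dots> = (\<Sum>p | p permutes \<beta>. of_int (sign p) * (\<Prod>i\<in>\<beta>. A $$ (i, p i)))"
  proof (intro sum.cong refl arg_cong2[where f = times])
    fix p assume "p \<in> {p. p permutes \<beta>}"
    then have p: "p permutes \<beta>" by simp
    have "(\<Prod>i = 0..<n. ?M $$ (i, p i)) = (\<Prod>i\<in>\<beta>. ?M $$ (i, p i))"
      using A sub permutes_not_in[OF p]
      by (intro prod.mono_neutral_right) auto
    also have "\<dots> = (\<Prod>i\<in>\<beta>. A $$ (i, p i))"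
      using A sub permutes_in_image[OF p] by (intro prod.cong) (auto simp: subset_iff)
    finally show "(\<Prod>i = 0..<n. ?M $$ (i, p i)) = (\<Prod>i\<in>\<beta>. A $$ (i, p i))" .
  qed
  finally show ?thesis
    using det_submatrix_eq_sum_permutes[OF A sub] by simp
qed

lemma det_submatrix_single:
  assumes "A \<in> carrier_mat n n" "x < n"
  shows "principal_minor A {x} = A $$ (x, x)"
  using assms by (simp add: det_submatrix_eq_sum_permutes)

lemma det_submatrix_doubleton:
  fixes A :: "'a :: comm_ring_1 mat"
  assumes A: "A \<in> carrier_mat n n" and "x < n" "y < n" "x \<noteq> y"
  shows "principal_minor A {x, y} = A $$ (x, x) * A $$ (y, y) - A $$ (x, y) * A $$ (y, x)"
proof -
  have perms: "{p. p permutes {x, y}} = {id, Transposition.transpose x y}"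
    by (auto simp: permutes_doubleton_iff)
  have ne: "id \<noteq> Transposition.transpose x y"
    using \<open>x \<noteq> y\<close> by (metis id_apply transpose_apply_first)
  have "principal_minor A {x, y} =
      (\<Sum>p\<in>{id, Transposition.transpose x y}. of_int (sign p) * (\<Prod>i\<in>{x, y}. A $$ (i, p i)))"
    using assms by (subst det_submatrix_eq_sum_permutes[OF A]) (auto simp: perms)
  then show ?thesis
    using ne \<open>x \<noteq> y\<close> by (simp add: sign_swap_id)
qed

lemma det_submatrix_row_0:
  fixes A :: "'a :: comm_ring_1 mat"
  assumes A: "A \<in> carrier_mat n n" and sub: "\<beta> \<subseteq> {..<n}"
    and x: "x \<in> \<beta>" and zero: "\<And>y. y \<in> \<beta> \<Longrightarrow> A $$ (x, y) = 0"
  shows "principal_minor A \<beta> = 0"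
proof -
  have fin: "finite \<beta>" using sub finite_subset by blast
  have "(\<Prod>i\<in>\<beta>. A $$ (i, p i)) = 0" if "p permutes \<beta>" for p
    using that x zero fin permutes_in_image[OF that] by (intro prod_zero) auto
  then show ?thesis
    by (subst det_submatrix_eq_sum_permutes[OF A sub]) (auto intro!: sum.neutral)
qed

section \<open>Principal pivoting of a symmetric matrix\<close>

lemma index_mult_mat_sum:
  assumes "X \<in> carrier_mat n m" "Y \<in> carrier_mat m p" "i < n" "j < p"
  shows "(X * Y) $$ (i, j) = (\<Sum>l = 0..<m. X $$ (i, l) * Y $$ (l, j))"
  using assms by (auto simp: scalar_prod_def)

lemma mult_mix_cols_one:
  fixes G :: "'a :: comm_ring_1 mat"
  assumes G: "G \<in> carrier_mat n n" and A: "A \<in> carrier_mat n n"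
  shows "G * mix_cols \<beta> A (1\<^sub>m n) = mix_cols \<beta> (G * A) G"
proof (rule eq_matI)
  fix i j assume "i < dim_row (mix_cols \<beta> (G * A) G)" "j < dim_col (mix_cols \<beta> (G * A) G)"
  then have ij: "i < n" "j < n" using G A by (auto simp: mix_cols_def)
  have "(G * mix_cols \<beta> A (1\<^sub>m n)) $$ (i, j) =
      (\<Sum>l = 0..<n. G $$ (i, l) * mix_cols \<beta> A (1\<^sub>m n) $$ (l, j))"
    using G A ij by (intro index_mult_mat_sum) auto
  also have "\<dots> = (if j \<in> \<beta> then \<Sum>l = 0..<n. G $$ (i, l) * A $$ (l, j) else G $$ (i, j))"
  proof (cases "j \<in> \<beta>")
    case True
    then show ?thesis using A ij by (auto intro!: sum.cong)
  next
    case False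
    have "(\<Sum>l = 0..<n. G $$ (i, l) * mix_cols \<beta> A (1\<^sub>m n) $$ (l, j)) =
        (\<Sum>l = 0..<n. if l = j then G $$ (i, j) else 0)"
      using A ij False by (intro sum.cong) auto
    then show ?thesis using ij False by simp
  qed
  also have "(\<Sum>l = 0..<n. G $$ (i, l) * A $$ (l, j)) = (G * A) $$ (i, j)"
    using G A ij by (intro index_mult_mat_sum[symmetric]) auto
  also have "(if j \<in> \<beta> then (G * A) $$ (i, j) else G $$ (i, j)) = mix_cols \<beta> (G * A) G $$ (i, j)"
    using G A ij by (auto simp: mix_cols_def)
  finally show "(G * mix_cols \<beta> A (1\<^sub>m n)) $$ (i, j) = mix_cols \<beta> (G * A) G $$ (i, j)" .
qed (use G A in \<open>auto simp: mix_cols_def\<close>)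

lemma det_nonzero_imp_inverse:
  fixes G :: "'a :: field mat"
  assumes G: "G \<in> carrier_mat n n" and "det G \<noteq> 0"
  obtains H where "H \<in> carrier_mat n n" "G * H = 1\<^sub>m n" "H * G = 1\<^sub>m n"
proof -
  define H where "H = inverse (det G) \<cdot>\<^sub>m adj_mat G"
  have H: "H \<in> carrier_mat n n"
    using adj_mat(1)[OF G] by (simp add: H_def)
  have "G * H = inverse (det G) \<cdot>\<^sub>m (G * adj_mat G)"
    unfolding H_def using G adj_mat(1)[OF G] by (simp add: mult_smult_distrib[of G n n])
  then have "G * H = 1\<^sub>m n"
    using adj_mat(2)[OF G] assms(2) by (intro eq_matI) auto
  then show thesis
    using that[OF H] mat_mult_left_right_inverse[OF G H] by blast
qed

text \<open>
  The matrix \<open>A\<close> expresses the columns of \<open>[B | I]\<close> that are not in the basis \<open>G\<close> belonging to \<open>\<gamma>\<close> in terms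
  of that basis. Exchanging the columns of \<open>\<beta>\<close> turns \<open>G\<close> into the selection for \<open>\<gamma> \<triangle> \<beta>\<close>, and this exchange
  is multiplication by the identity matrix with the columns of \<open>\<beta>\<close> replaced by those of \<open>A\<close>.
  For the symmetry, let \<open>D\<close> be the diagonal matrix with \<open>- 1\<close> on \<open>\<gamma>\<close> and \<open>1\<close> elsewhere: with \<open>H\<close> the
  inverse of \<open>G\<close>, the matrix \<open>A D\<close> is congruent, through \<open>H\<close>, to a matrix \<open>T\<close> that is visibly
  symmetric.
\<close>

lemma principal_pivot_transform:
  fixes B :: "'a :: field mat"
  assumes B: "B \<in> carrier_mat n n" and sym: "symmetric_mat B"
    and sub: "\<gamma> \<subseteq> {..<n}" and feasible: "principal_minor B \<gamma> \<noteq> 0"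
  obtains A where "A \<in> carrier_mat n n"
    and "\<And>\<beta>. \<beta> \<subseteq> {..<n} \<Longrightarrow> principal_minor B (sym_diff \<gamma> \<beta>) =
           principal_minor B \<gamma> * principal_minor A \<beta>"
    and "\<And>x y. x < n \<Longrightarrow> y < n \<Longrightarrow>
           A $$ (y, x) = (if x \<in> \<gamma> \<longleftrightarrow> y \<in> \<gamma> then A $$ (x, y) else - A $$ (x, y))"
proof -
  define G where "G = mix_cols \<gamma> B (1\<^sub>m n)"
  define C where "C = mix_cols \<gamma> (1\<^sub>m n) B"
  define D where "D = (mat n n (\<lambda>(i, j). if i = j then if i \<in> \<gamma> then - 1 else 1 else 0) :: 'a mat)"
  have [simp]: "dim_row B = n" "dim_col B = n" using B by auto
  have G: "G \<in> carrier_mat n n" and C: "C \<in> carrier_mat n n" and D: "D \<in> carrier_mat n n"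
    using B by (simp_all add: G_def C_def D_def)
  have G_index: "G $$ (i, j) = (if j \<in> \<gamma> then B $$ (i, j) else if i = j then 1 else 0)"
    and C_index: "C $$ (i, j) = (if j \<in> \<gamma> then if i = j then 1 else 0 else B $$ (i, j))"
    if "i < n" "j < n" for i j
    using that by (simp_all add: G_def C_def mix_cols_def)
  have B_sym: "B $$ (i, j) = B $$ (j, i)" if "i < n" "j < n" for i j
    using sym that index_transpose_mat(1)[of i B j] by (simp add: symmetric_mat_def)
  have det_G: "det G = principal_minor B \<gamma>"
    unfolding G_def by (rule det_mix_cols_one[OF B sub])
  obtain H where H: "H \<in> carrier_mat n n" and GH: "G * H = 1\<^sub>m n" and HG: "H * G = 1\<^sub>m n"
    using det_nonzero_imp_inverse[OF G] feasible det_G by auto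
  define A where "A = H * C"
  have A: "A \<in> carrier_mat n n" unfolding A_def using H C by simp
  have GA: "G * A = C"
    unfolding A_def using assoc_mult_mat[OF G H C] GH C by simp
  have pivot: "principal_minor B (sym_diff \<gamma> \<beta>) =
      principal_minor B \<gamma> * principal_minor A \<beta>" if \<beta>: "\<beta> \<subseteq> {..<n}" for \<beta>
  proof -
    have "mix_cols (sym_diff \<gamma> \<beta>) B (1\<^sub>m n) = mix_cols \<beta> C G"
      using G C by (intro eq_matI) (auto simp: mix_cols_def G_index C_index)
    also have "\<dots> = G * mix_cols \<beta> A (1\<^sub>m n)"
      using mult_mix_cols_one[OF G A] GA by simp
    finally have "det (mix_cols (sym_diff \<gamma> \<beta>) B (1\<^sub>m n)) = det G * det (mix_cols \<beta> A (1\<^sub>m n))"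
      using det_mult[OF G, of "mix_cols \<beta> A (1\<^sub>m n)"] A by simp
    moreover have "sym_diff \<gamma> \<beta> \<subseteq> {..<n}" using sub \<beta> by auto
    ultimately show ?thesis
      using det_mix_cols_one[OF B] det_mix_cols_one[OF A \<beta>] det_G by metis
  qed
  have times_D: "(X * D) $$ (i, j) = (if j \<in> \<gamma> then - X $$ (i, j) else X $$ (i, j))"
    if "X \<in> carrier_mat n n" "i < n" "j < n" for X i j
  proof -
    have "(X * D) $$ (i, j) = (\<Sum>l = 0..<n. X $$ (i, l) * D $$ (l, j))"
      using that D by (intro index_mult_mat_sum) auto
    also have "\<dots> = (\<Sum>l = 0..<n. if l = j then if j \<in> \<gamma> then - X $$ (i, j) else X $$ (i, j) else 0)"
      using that by (intro sum.cong) (auto simp: D_def)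
    finally show ?thesis using that by simp
  qed
  \<comment> \<open>\<open>T = B - P * B - B * P\<close>, where \<open>P\<close> is the diagonal projection onto the coordinates in \<open>\<gamma>\<close>\<close>
  define T where "T = C * D * transpose_mat G"
  have T: "T \<in> carrier_mat n n" unfolding T_def using C D G by simp
  have T_index: "T $$ (i, j) = (if i \<in> \<gamma> then - B $$ (i, j) else 0) + (if j \<in> \<gamma> then 0 else B $$ (i, j))"
    if ij: "i < n" "j < n" for i j
  proof -
    have "T $$ (i, j) = (\<Sum>l = 0..<n. (C * D) $$ (i, l) * transpose_mat G $$ (l, j))"
      unfolding T_def using C D G ij by (intro index_mult_mat_sum) auto
    also have "\<dots> = (\<Sum>l = 0..<n. (if l = i then if i \<in> \<gamma> then - B $$ (i, j) else 0 else 0) +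
        (if l = j then if j \<in> \<gamma> then 0 else B $$ (i, j) else 0))"
      using ij G by (intro sum.cong) (auto simp: times_D[OF C] C_index G_index B_sym[of j i])
    finally show ?thesis using ij by (simp add: sum.distrib)
  qed
  have T_sym: "transpose_mat T = T"
    using T B_sym by (intro eq_matI) (auto simp: T_index)
  have "A * D = H * T * transpose_mat H"
  proof -
    have GtHt: "transpose_mat G * transpose_mat H = 1\<^sub>m n"
      using transpose_mult[OF H G] HG by simp
    have CD: "C * D \<in> carrier_mat n n" using C D by simp
    have "T * transpose_mat H = C * D * (transpose_mat G * transpose_mat H)"
      unfolding T_def using CD G H by (intro assoc_mult_mat) auto
    then have "T * transpose_mat H = C * D" using GtHt CD right_mult_one_mat[OF CD] by simp
    then have "H * T * transpose_mat H = H * (C * D)"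
      using assoc_mult_mat[OF H T, of "transpose_mat H" n] H by simp
    then show ?thesis unfolding A_def using assoc_mult_mat[OF H C D] by simp
  qed
  moreover have "transpose_mat (H * T * transpose_mat H) = H * T * transpose_mat H"
    using H T T_sym transpose_mult[OF H T] transpose_mult[of "H * T" n n "transpose_mat H" n]
      assoc_mult_mat[OF H T, of "transpose_mat H" n] by simp
  ultimately have "transpose_mat (A * D) = A * D" by simp
  then have AD_sym: "(A * D) $$ (x, y) = (A * D) $$ (y, x)" if "x < n" "y < n" for x y
    using that A D index_transpose_mat(1)[of x "A * D" y] by simp
  show thesis
  proof (rule that[OF A pivot])
    fix x y assume "x < n" "y < n"
    then show "A $$ (y, x) = (if x \<in> \<gamma> \<longleftrightarrow> y \<in> \<gamma> then A $$ (x, y) else - A $$ (x, y))"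
      using AD_sym[of x y] by (auto simp: times_D[OF A] split: if_splits)
  qed
qed

section \<open>Symmetric exchange and the signs around a vanishing order\<close>

text \<open>
  The exchange axiom of delta-matroids, with signs. The indices \<open>x\<close> and \<open>y\<close> are both inside or
  both outside \<open>\<gamma>\<close> exactly if the sizes of \<open>\<gamma>\<close> and \<open>\<gamma> \<triangle> {x, y}\<close> differ by two.
\<close>

lemma symmetric_exchange:
  fixes B :: "'a :: linordered_field mat"
  assumes B: "B \<in> carrier_mat n n" and sym: "symmetric_mat B"
    and \<gamma>: "\<gamma> \<subseteq> {..<n}" "principal_minor B \<gamma> \<noteq> 0"
    and \<delta>: "\<delta> \<subseteq> {..<n}" "principal_minor B \<delta> \<noteq> 0"
    and x: "x \<in> sym_diff \<gamma> \<delta>" and zero: "principal_minor B (sym_diff \<gamma> {x}) = 0"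
  obtains y where "y \<in> sym_diff \<gamma> \<delta>" "y \<noteq> x"
    "if x \<in> \<gamma> \<longleftrightarrow> y \<in> \<gamma> then principal_minor B \<gamma> * principal_minor B (sym_diff \<gamma> {x, y}) < 0
     else principal_minor B \<gamma> * principal_minor B (sym_diff \<gamma> {x, y}) > 0"
proof -
  obtain A where A: "A \<in> carrier_mat n n"
    and pivot: "\<And>\<beta>. \<beta> \<subseteq> {..<n} \<Longrightarrow>
      principal_minor B (sym_diff \<gamma> \<beta>) = principal_minor B \<gamma> * principal_minor A \<beta>"
    and A_sym: "\<And>x y. x < n \<Longrightarrow> y < n \<Longrightarrow>
      A $$ (y, x) = (if x \<in> \<gamma> \<longleftrightarrow> y \<in> \<gamma> then A $$ (x, y) else - A $$ (x, y))"
    using principal_pivot_transform[OF B sym \<gamma>] by blast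
  let ?\<beta> = "sym_diff \<gamma> \<delta>"
  have \<beta>: "?\<beta> \<subseteq> {..<n}" using \<gamma>(1) \<delta>(1) by auto
  have "sym_diff \<gamma> ?\<beta> = \<delta>" by auto
  with pivot[OF \<beta>] \<delta>(2) have "principal_minor A ?\<beta> \<noteq> 0" by auto
  then obtain y where y: "y \<in> ?\<beta>" "A $$ (x, y) \<noteq> 0"
    using det_submatrix_row_0[OF A \<beta> x] by blast
  have lt: "x < n" "y < n" using \<beta> x y(1) by auto
  have Axx: "A $$ (x, x) = 0"
    using pivot[of "{x}"] zero \<gamma>(2) lt(1) det_submatrix_single[OF A lt(1)] by simp
  with y have "y \<noteq> x" by auto
  then have "principal_minor B (sym_diff \<gamma> {x, y}) = principal_minor B \<gamma> * - (A $$ (x, y) * A $$ (y, x))"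
    using pivot[of "{x, y}"] lt Axx det_submatrix_doubleton[OF A lt] by simp
  then have eq: "principal_minor B \<gamma> * principal_minor B (sym_diff \<gamma> {x, y}) =
      (principal_minor B \<gamma>)\<^sup>2 * - (A $$ (x, y) * A $$ (y, x))"
    by (simp add: power2_eq_square)
  have pos: "(principal_minor B \<gamma>)\<^sup>2 * (A $$ (x, y) * A $$ (x, y)) > 0"
    using \<gamma>(2) y(2) by (simp flip: power2_eq_square)
  show thesis
    by (rule that[OF y(1) \<open>y \<noteq> x\<close>]) (use pos in \<open>simp add: eq A_sym[OF lt]\<close>)
qed

lemma card_sym_diff_single:
  assumes "finite \<gamma>"
  shows "card (sym_diff \<gamma> {x}) = (if x \<in> \<gamma> then card \<gamma> - 1 else Suc (card \<gamma>))"
proof -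
  have "sym_diff \<gamma> {x} = (if x \<in> \<gamma> then \<gamma> - {x} else insert x \<gamma>)" by auto
  then show ?thesis using assms by simp
qed

text \<open>
  Around an order \<open>k + 1\<close> without nonzero minors, the nonzero minors of orders \<open>k\<close> and \<open>k + 2\<close> have opposite
  signs; this normalisation makes them comparable.
\<close>

definition signed_minor :: "nat \<Rightarrow> 'a :: comm_ring_1 mat \<Rightarrow> nat set \<Rightarrow> 'a" where
  "signed_minor k B \<gamma> = (if card \<gamma> = k then - principal_minor B \<gamma> else principal_minor B \<gamma>)"

text \<open>
  Induction on the size of \<open>\<gamma> \<triangle> \<delta>\<close>. Choose \<open>x\<close> in it such that \<open>\<gamma> \<triangle> {x}\<close> has the forbidden size
  \<open>k + 1\<close>: from \<open>\<delta>\<close> if \<open>\<gamma>\<close> has size \<open>k\<close>, and from \<open>\<gamma>\<close> if it has size \<open>k + 2\<close>. The exchange then has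
  to move a second index \<open>y\<close>, ends in a feasible set of size \<open>k\<close> or \<open>k + 2\<close> that is closer to \<open>\<delta>\<close>,
  and keeps the sign of the signed minor.
\<close>

lemma signed_minors_agree:
  fixes B :: "'a :: linordered_field mat"
  assumes B: "B \<in> carrier_mat n n" and sym: "symmetric_mat B"
    and zero: "\<And>\<alpha>. \<alpha> \<subseteq> {..<n} \<Longrightarrow> card \<alpha> = Suc k \<Longrightarrow> principal_minor B \<alpha> = 0"
  assumes "\<gamma> \<subseteq> {..<n}" "card \<gamma> \<in> {k, Suc (Suc k)}" "principal_minor B \<gamma> \<noteq> 0"
    and "\<delta> \<subseteq> {..<n}" "card \<delta> \<in> {k, Suc (Suc k)}" "principal_minor B \<delta> \<noteq> 0"
  shows "signed_minor k B \<gamma> * signed_minor k B \<delta> > 0"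
  using assms(4-)
proof (induction "card (sym_diff \<gamma> \<delta>)" arbitrary: \<gamma> rule: less_induct)
  case less
  note \<gamma> = less.prems(1-3) and \<delta> = less.prems(4-6)
  have fin: "finite \<gamma>" "finite \<delta>" using \<gamma>(1) \<delta>(1) finite_subset by blast+
  show ?case
  proof (cases "\<gamma> = \<delta>")
    case True
    then show ?thesis
      using \<gamma>(3) by (auto simp: signed_minor_def zero_less_mult_iff)
  next
    case False
    obtain x where x: "x \<in> sym_diff \<gamma> \<delta>" "card (sym_diff \<gamma> {x}) = Suc k"
    proof (cases "card \<gamma> = k")
      case True
      then have "\<not> \<delta> \<subseteq> \<gamma>"
        using False \<delta>(2) card_mono[OF fin(1), of \<delta>] card_subset_eq[OF fin(1), of \<delta>] by auto
      then obtain x where "x \<in> \<delta> - \<gamma>" by blast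
      then show thesis
        using that[of x] True card_sym_diff_single[OF fin(1), of x] by auto
    next
      case 2: False
      then have "\<not> \<gamma> \<subseteq> \<delta>"
        using False \<gamma>(2) \<delta>(2) card_mono[OF fin(2), of \<gamma>] card_subset_eq[OF fin(2), of \<gamma>] by auto
      then obtain x where "x \<in> \<gamma> - \<delta>" by blast
      then show thesis
        using that[of x] 2 \<gamma>(2) card_sym_diff_single[OF fin(1), of x] by auto
    qed
    have "sym_diff \<gamma> {x} \<subseteq> {..<n}" using \<gamma>(1) \<delta>(1) x(1) by auto
    from symmetric_exchange[OF B sym \<gamma>(1,3) \<delta>(1,3) x(1) zero[OF this x(2)]]
    obtain y where y: "y \<in> sym_diff \<gamma> \<delta>" "y \<noteq> x" and
      sgn: "if x \<in> \<gamma> \<longleftrightarrow> y \<in> \<gamma> then principal_minor B \<gamma> * principal_minor B (sym_diff \<gamma> {x, y}) < 0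
       else principal_minor B \<gamma> * principal_minor B (sym_diff \<gamma> {x, y}) > 0"
      by blast
    define \<gamma>' where "\<gamma>' = sym_diff \<gamma> {x, y}"
    have "\<gamma>' = sym_diff (sym_diff \<gamma> {x}) {y}" using y(2) by (auto simp: \<gamma>'_def)
    then have card_\<gamma>': "card \<gamma>' = (if y \<in> \<gamma> then k else Suc (Suc k))"
      using card_sym_diff_single[of "sym_diff \<gamma> {x}" y] fin(1) x(2) y(2) by auto
    have card_\<gamma>: "card \<gamma> = (if x \<in> \<gamma> then Suc (Suc k) else k)"
      using card_sym_diff_single[OF fin(1), of x] x(2) \<gamma>(2) by (auto split: if_splits)
    have step: "signed_minor k B \<gamma> * signed_minor k B \<gamma>' > 0"
      using sgn card_\<gamma> card_\<gamma>' by (auto simp: signed_minor_def \<gamma>'_def[symmetric] split: if_splits)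
    have "sym_diff \<gamma>' \<delta> \<subset> sym_diff \<gamma> \<delta>" using x(1) y(1) by (auto simp: \<gamma>'_def)
    then have "card (sym_diff \<gamma>' \<delta>) < card (sym_diff \<gamma> \<delta>)"
      using fin by (intro psubset_card_mono) auto
    moreover have "\<gamma>' \<subseteq> {..<n}" using \<gamma>(1) \<delta>(1) x(1) y(1) by (auto simp: \<gamma>'_def)
    moreover have "principal_minor B \<gamma>' \<noteq> 0"
      using sgn by (auto simp: \<gamma>'_def split: if_splits)
    ultimately have "signed_minor k B \<gamma>' * signed_minor k B \<delta> > 0"
      using less.hyps[of \<gamma>'] card_\<gamma>' \<delta> by auto
    with step show ?thesis
      by (auto simp: zero_less_mult_iff)
  qed
qed

section \<open>Sign patterns and the symbols of the sequence\<close>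

definition symbol_of_signs :: "bool \<Rightarrow> bool \<Rightarrow> bool \<Rightarrow> sepr_symbol" where
  "symbol_of_signs has_pos has_neg has_zero =
     (if has_pos then if has_neg then if has_zero then Sstar else Astar else if has_zero then Splus else Aplus
      else if has_neg then if has_zero then Sminus else Aminus else N)"

text \<open>
  The three questions whether a positive, a negative or a zero minor of order \<open>k\<close> exists already
  decide the term: the universal conditions in its definition are negations of these, and one of the
  three holds because there is a minor at all.
\<close>

lemma sepr_term_eq_symbol_of_signs:
  assumes "k \<le> dim_row B"
  defines "M \<equiv> principal_minors B k"
  shows "sepr_term B k = symbol_of_signs (\<exists>u\<in>M. u > 0) (\<exists>u\<in>M. u < 0) (\<exists>u\<in>M. u = 0)"
proof -
  define p q z where "p = (\<exists>u\<in>M. u > 0)" and "q = (\<exists>u\<in>M. u < 0)" and "z = (\<exists>u\<in>M. u = 0)"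
  have "p \<or> q \<or> z"
    unfolding p_def q_def z_def M_def
    using principal_minors_nonempty[OF assms(1)] linorder_neqE_linordered_idom by blast
  moreover have "(\<exists>u\<in>M. u > 0) = p" "(\<exists>u\<in>M. u < 0) = q" "(\<exists>u\<in>M. u = 0) = z"
    by (simp_all only: p_def q_def z_def)
  moreover have "(\<forall>u\<in>M. u \<noteq> 0) = (\<not> z)" "(\<exists>u\<in>M. u \<noteq> 0) = (p \<or> q)"
    "(\<forall>u\<in>M. u > 0) = (\<not> q \<and> \<not> z)" "(\<forall>u\<in>M. u < 0) = (\<not> p \<and> \<not> z)"
    "(\<forall>u\<in>M. u = 0) = (\<not> p \<and> \<not> q)" "(\<forall>u\<in>M. u \<noteq> 0 \<longrightarrow> u > 0) = (\<not> q)"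
    unfolding p_def q_def z_def by (metis less_asym less_irrefl linorder_cases)+
  ultimately show ?thesis
    unfolding sepr_term_def symbol_of_signs_def Let_def M_def[symmetric] by (simp only:) auto
qed

text \<open>
  On minors of one fixed order \<open>m\<close> the normalisation is a common factor \<open>1\<close> or \<open>- 1\<close>, so agreement of
  the signed minors is agreement of the minors.
\<close>

lemma not_both_signs_next_to_N:
  assumes B: "B \<in> carrier_mat n n" and sym: "symmetric_mat B"
    and N: "sepr_term B (Suc k) = N" "Suc k \<le> n" and m: "m \<in> {k, Suc (Suc k)}"
  shows "\<not> ((\<exists>u\<in>principal_minors B m. u > 0) \<and> (\<exists>v\<in>principal_minors B m. v < 0))"
proof
  assume "(\<exists>u\<in>principal_minors B m. u > 0) \<and> (\<exists>v\<in>principal_minors B m. v < 0)"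
  then obtain \<gamma> \<delta> where \<gamma>: "\<gamma> \<subseteq> {..<n}" "card \<gamma> = m" "principal_minor B \<gamma> > 0"
    and \<delta>: "\<delta> \<subseteq> {..<n}" "card \<delta> = m" "principal_minor B \<delta> < 0"
    using B by (auto simp: principal_minors_def)
  have "\<not> (\<exists>u\<in>principal_minors B (Suc k). u > 0)" "\<not> (\<exists>u\<in>principal_minors B (Suc k). u < 0)"
    using N B sepr_term_eq_symbol_of_signs[of "Suc k" B]
    by (auto simp: symbol_of_signs_def split: if_splits)
  then have "\<forall>u\<in>principal_minors B (Suc k). u = 0"
    by (metis linorder_neqE_linordered_idom)
  then have "principal_minor B \<alpha> = 0" if "\<alpha> \<subseteq> {..<n}" "card \<alpha> = Suc k" for \<alpha>
    using that B by (auto simp: principal_minors_def)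
  then have "signed_minor k B \<gamma> * signed_minor k B \<delta> > 0"
    using \<gamma> \<delta> m by (intro signed_minors_agree[OF B sym]) auto
  then show False
    using \<gamma> \<delta> by (auto simp: signed_minor_def zero_less_mult_iff split: if_splits)
qed

lemma star_term_has_both_signs:
  assumes "sepr_term B m \<in> {Astar, Sstar}" "m \<le> dim_row B"
  shows "(\<exists>u\<in>principal_minors B m. u > 0) \<and> (\<exists>v\<in>principal_minors B m. v < 0)"
  using assms sepr_term_eq_symbol_of_signs[of m B]
  by (auto simp: symbol_of_signs_def split: if_splits)

lemma sublist_pair_sepr:
  assumes "sublist [x, y] (sepr B)"
  obtains k where "Suc (Suc k) \<le> dim_row B" "sepr_term B (Suc k) = x" "sepr_term B (Suc (Suc k)) = y"
proof -
  obtain ps ss where eq: "sepr B = ps @ [x, y] @ ss"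
    using assms by (auto simp: sublist_def)
  have len: "Suc (Suc (length ps)) \<le> dim_row B"
    using arg_cong[OF eq, of length] by (simp add: sepr_def del: upt_Suc)
  have "sepr B ! length ps = x" "sepr B ! Suc (length ps) = y"
    by (simp_all add: eq nth_append)
  then show thesis
    using that[of "length ps"] len by (simp add: sepr_def del: upt_Suc)
qed

section \<open>Evaluating the sequence of an integer matrix\<close>

text \<open>
  Laplace expansion along the first row. The row and column indices that are left are kept as lists,
  so that the evaluation needs only list operations.
\<close>

fun minor_by_rows :: "(nat \<Rightarrow> nat \<Rightarrow> 'a :: comm_ring_1) \<Rightarrow> nat list \<Rightarrow> nat list \<Rightarrow> 'a" where
  "minor_by_rows f [] js = 1"
| "minor_by_rows f (i # is) js =
     (\<Sum>c\<leftarrow>[0..<length js]. (- 1) ^ c * f i (js ! c) * minor_by_rows f is (take c js @ drop (Suc c) js))"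

lemma det_eq_minor_by_rows:
  assumes "length is = k" "length js = k"
  shows "det (mat k k (\<lambda>(r, c). f (is ! r) (js ! c))) = minor_by_rows f is js"
  using assms
proof (induction "is" arbitrary: js k)
  case Nil
  then show ?case by simp
next
  case (Cons i "is")
  then obtain m where k: "k = Suc m" by (cases k) auto
  let ?M = "mat k k (\<lambda>(r, c). f ((i # is) ! r) (js ! c))"
  have "det ?M = (\<Sum>c<k. ?M $$ (0, c) * cofactor ?M 0 c)"
    by (rule laplace_expansion_row) (simp_all add: k)
  also have "\<dots> = (\<Sum>c<k. (- 1) ^ c * f i (js ! c) * minor_by_rows f is (take c js @ drop (Suc c) js))"
  proof (rule sum.cong[OF refl])
    fix c assume "c \<in> {..<k}"
    then have c: "c < k" by simp
    have "mat_delete ?M 0 c = mat m m (\<lambda>(r, d). f (is ! r) ((take c js @ drop (Suc c) js) ! d))"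
      using Cons.prems c by (intro eq_matI) (auto simp: mat_delete_def k nth_append min_def)
    then have "det (mat_delete ?M 0 c) = minor_by_rows f is (take c js @ drop (Suc c) js)"
      using Cons.prems c k by (simp only:) (rule Cons.IH, auto)
    then show "?M $$ (0, c) * cofactor ?M 0 c =
        (- 1) ^ c * f i (js ! c) * minor_by_rows f is (take c js @ drop (Suc c) js)"
      using c by (simp add: cofactor_def)
  qed
  finally show ?case
    using Cons.prems by (simp add: sum_list_distinct_conv_sum_set atLeast0LessThan)
qed

text \<open>
  Transfers evaluation from the reals to the integers, where it is executable symbolically.
\<close>

lemma of_int_minor_by_rows:
  "minor_by_rows (\<lambda>i j. of_int (f i j)) is js = (of_int (minor_by_rows f is js) :: 'a :: comm_ring_1)"
  by (induction "is" arbitrary: js) (simp_all add: sum_list_distinct_conv_sum_set del: upt_Suc)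

definition mat_of_rows_int :: "int list list \<Rightarrow> real mat" where
  "mat_of_rows_int rs = mat (length rs) (length rs) (\<lambda>(i, j). of_int (rs ! i ! j))"

definition minors_list :: "int list list \<Rightarrow> nat \<Rightarrow> int list" where
  "minors_list rs k =
     map (\<lambda>is. minor_by_rows (\<lambda>i j. rs ! i ! j) is is) (filter (\<lambda>is. length is = k) (subseqs [0..<length rs]))"

lemma det_submatrix_eq_minor_by_rows:
  assumes "\<alpha> \<subseteq> {..<length rs}"
  shows "det (submatrix (mat_of_rows_int rs) \<alpha> \<alpha>) =
    of_int (minor_by_rows (\<lambda>i j. rs ! i ! j) (nths [0..<length rs] \<alpha>) (nths [0..<length rs] \<alpha>))"
proof -
  let ?n = "length rs" let ?is = "nths [0..<length rs] \<alpha>"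
  have card_eq: "card {i. i < ?n \<and> i \<in> \<alpha>} = length ?is" by (simp add: length_nths)
  have pick_eq: "pick \<alpha> r = ?is ! r" "pick \<alpha> r < ?n" if "r < length ?is" for r
  proof -
    have r: "r < card {i. i < ?n \<and> i \<in> \<alpha>}" using that card_eq by simp
    then show "pick \<alpha> r < ?n" using pick_le by blast
    then show "pick \<alpha> r = ?is ! r" using nth_nths[of r "[0..<length rs]" \<alpha>] r by simp
  qed
  have "submatrix (mat_of_rows_int rs) \<alpha> \<alpha> =
      mat (length ?is) (length ?is) (\<lambda>(r, c). of_int (rs ! (?is ! r) ! (?is ! c)))"
    using pick_eq unfolding submatrix_def by (auto simp: mat_of_rows_int_def card_eq cong: conj_cong)
  then show ?thesis
    by (simp only: det_eq_minor_by_rows[of ?is "length ?is" ?is "\<lambda>i j. of_int (rs ! i ! j)"] of_int_minor_by_rows)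
qed

text \<open>
  The sublists of \<open>[0..<n]\<close> are the subsets of \<open>{..<n}\<close>, each written in increasing order, which is the
  order in which a submatrix arranges its rows and columns.
\<close>

lemma principal_minors_mat_of_rows_int:
  "principal_minors (mat_of_rows_int rs) k = of_int ` set (minors_list rs k)"
proof -
  let ?n = "length rs"
  let ?m = "\<lambda>is. of_int (minor_by_rows (\<lambda>i j. rs ! i ! j) is is) :: real"
  have sets: "{is \<in> set (subseqs [0..<?n]). length is = k} =
      (\<lambda>\<alpha>. nths [0..<?n] \<alpha>) ` {\<alpha>. \<alpha> \<subseteq> {..<?n} \<and> card \<alpha> = k}"
  proof (intro equalityI subsetI)
    fix "is" assume "is \<in> {is \<in> set (subseqs [0..<?n]). length is = k}"
    then obtain \<alpha> where \<alpha>: "is = nths [0..<?n] \<alpha>" "length is = k"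
      by (auto simp: subseq_conv_nths)
    have "is = nths [0..<?n] (\<alpha> \<inter> {..<?n})"
      unfolding \<alpha>(1) nths_def by (intro arg_cong[where f = "map fst"] filter_cong) (auto simp: set_zip)
    moreover have "card (\<alpha> \<inter> {..<?n}) = k"
      using \<alpha> by (auto simp: length_nths intro!: arg_cong[where f = card])
    ultimately show "is \<in> (\<lambda>\<alpha>. nths [0..<?n] \<alpha>) ` {\<alpha>. \<alpha> \<subseteq> {..<?n} \<and> card \<alpha> = k}" by blast
  next
    fix "is" assume "is \<in> (\<lambda>\<alpha>. nths [0..<?n] \<alpha>) ` {\<alpha>. \<alpha> \<subseteq> {..<?n} \<and> card \<alpha> = k}"
    then obtain \<alpha> where \<alpha>: "is = nths [0..<?n] \<alpha>" "\<alpha> \<subseteq> {..<?n}" "card \<alpha> = k" by auto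
    then have "{i. i < ?n \<and> i \<in> \<alpha>} = \<alpha>" by auto
    with \<alpha> show "is \<in> {is \<in> set (subseqs [0..<?n]). length is = k}"
      by (auto simp: subseq_conv_nths length_nths)
  qed
  have "principal_minors (mat_of_rows_int rs) k =
      (\<lambda>\<alpha>. ?m (nths [0..<?n] \<alpha>)) ` {\<alpha>. \<alpha> \<subseteq> {..<?n} \<and> card \<alpha> = k}"
    unfolding principal_minors_def
    by (intro image_cong) (auto simp: det_submatrix_eq_minor_by_rows, auto simp: mat_of_rows_int_def)
  also have "\<dots> = ?m ` {is \<in> set (subseqs [0..<?n]). length is = k}"
    unfolding sets by (simp add: image_image)
  also have "\<dots> = of_int ` set (minors_list rs k)"
    by (simp add: minors_list_def image_image)
  finally show ?thesis .
qed

definition sepr_rows :: "int list list \<Rightarrow> sepr_symbol list" where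
  "sepr_rows rs = map (\<lambda>k. let ms = minors_list rs k in
     symbol_of_signs (list_ex (\<lambda>u. u > 0) ms) (list_ex (\<lambda>u. u < 0) ms) (list_ex (\<lambda>u. u = 0) ms))
     [1..<Suc (length rs)]"

lemma sepr_mat_of_rows_int: "sepr (mat_of_rows_int rs) = sepr_rows rs"
  unfolding sepr_def sepr_rows_def Let_def
proof (intro map_cong)
  fix k assume "k \<in> set [1..<Suc (length rs)]"
  then have "k \<le> dim_row (mat_of_rows_int rs)" by (auto simp: mat_of_rows_int_def)
  then show "sepr_term (mat_of_rows_int rs) k =
      symbol_of_signs (list_ex (\<lambda>u. u > 0) (minors_list rs k)) (list_ex (\<lambda>u. u < 0) (minors_list rs k))
        (list_ex (\<lambda>u. u = 0) (minors_list rs k))"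
    by (simp add: sepr_term_eq_symbol_of_signs principal_minors_mat_of_rows_int list_ex_iff image_iff)
qed (simp add: mat_of_rows_int_def)

lemma symmetric_mat_of_rows_int:
  assumes "\<forall>i<length rs. \<forall>j<length rs. rs ! i ! j = rs ! j ! i"
  shows "symmetric_mat (mat_of_rows_int rs)"
  using assms unfolding symmetric_mat_def mat_of_rows_int_def by (intro eq_matI) auto

section \<open>Matrices attaining the other pairs\<close>

text \<open>
  One matrix serves several pairs: a sequence of order 4 contains three of them, one of order 3 two.
\<close>

definition witnesses :: "int list list list" where
  "witnesses =
   [[[0,0,0,0], [0,0,1,1], [0,1,0,1], [0,1,1,0]],
    [[0,0,1,1], [0,1,0,0], [1,0,1,0], [1,0,0,1]],
    [[-1,1,0,1], [1,0,1,0], [0,1,1,0], [1,0,0,0]],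
    [[-1,2,0,2], [2,-1,0,2], [0,0,-1,0], [2,2,0,-1]],
    [[-1,1,0,0], [1,-1,1,0], [0,1,1,1], [0,0,1,1]],
    [[1,0,0,1], [0,1,1,0], [0,1,1,1], [1,0,1,1]],
    [[-1,1,0,2], [1,-1,0,1], [0,0,-1,0], [2,1,0,-1]],
    [[1,0,1,0], [0,1,2,0], [1,2,1,0], [0,0,0,1]],
    [[1,1,1,2], [1,1,1,2], [1,1,1,2], [2,2,2,1]],
    [[0,-1,1,1], [-1,-2,1,1], [1,1,0,1], [1,1,1,-1]],
    [[0,-3,1,2], [-3,0,1,1], [1,1,0,-2], [2,1,-2,0]],
    [[1,0,1], [0,1,1], [1,1,2]],
    [[0,1,1,1], [1,2,1,1], [1,1,0,2], [1,1,2,1]],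
    [[-1,1,1,0], [1,-1,1,0], [1,1,-1,0], [0,0,0,-1]],
    [[1,2,2,0], [2,1,2,0], [2,2,1,0], [0,0,0,1]],
    [[-1,1,1], [1,-1,1], [1,1,-1]],
    [[-1,1,2], [1,-1,1], [2,1,-1]],
    [[-1,1,0,1], [1,-1,0,1], [0,0,0,0], [1,1,0,-1]]]"

lemma sepr_witnesses:
  "map sepr_rows witnesses =
   [[N,Sminus,Splus,N],
    [Splus,Sstar,Astar,Aminus],
    [Sstar,Sminus,Sminus,Aplus],
    [Aminus,Astar,Aplus,Aminus],
    [Astar,Sminus,Sstar,Aplus],
    [Aplus,Splus,Sminus,Aminus],
    [Aminus,Sstar,Splus,Aminus],
    [Aplus,Sstar,Sstar,Aminus],
    [Aplus,Sminus,N,N],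
    [Sminus,Astar,Splus,Aplus],
    [N,Aminus,Aminus,Aplus],
    [Aplus,Aplus,N],
    [Splus,Astar,Sstar,Aplus],
    [Aminus,Splus,Splus,Aminus],
    [Aplus,Astar,Astar,Aplus],
    [Aminus,N,Aplus],
    [Aminus,Sminus,Aplus],
    [Sminus,N,Splus,N]]"
  by code_simp

lemma symmetric_witnesses:
  "\<forall>rs\<in>set witnesses. rs \<noteq> [] \<and> (\<forall>i<length rs. \<forall>j<length rs. rs ! i ! j = rs ! j ! i)"
  by code_simp

lemma pair_in_witness:
  assumes "[x, y] \<notin> {[Astar, N], [N, Astar], [N, Sstar], [Sstar, N]}"
  shows "\<exists>ts\<in>set (map sepr_rows witnesses). sublist [x, y] ts"
  using assms unfolding sepr_witnesses
  by (cases x; cases y; simp add: sublist_Cons_right)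

lemma attained_pair:
  assumes "[x, y] \<notin> {[Astar, N], [N, Astar], [N, Sstar], [Sstar, N]}"
  shows "\<exists>(n::nat) (B::real mat). n \<ge> 1 \<and> B \<in> carrier_mat n n \<and> symmetric_mat B \<and> sublist [x, y] (sepr B)"
proof -
  obtain rs where rs: "rs \<in> set witnesses" "sublist [x, y] (sepr_rows rs)"
    using pair_in_witness[OF assms] by auto
  with symmetric_witnesses have "length rs \<ge> 1" "symmetric_mat (mat_of_rows_int rs)"
    by (auto intro!: symmetric_mat_of_rows_int simp: Suc_le_eq)
  then show ?thesis
    using rs(2) by (intro exI[of _ "length rs"] exI[of _ "mat_of_rows_int rs"])
      (simp add: sepr_mat_of_rows_int, simp add: mat_of_rows_int_def)
qed

section \<open>Characterisation of the pairs that never occur\<close>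

theorem theorem5p1:
  fixes xs :: "sepr_symbol list"
  assumes "length xs = 2"
  shows "(\<not> (\<exists>(n::nat) (B::real mat).
              n \<ge> 1 \<and> B \<in> carrier_mat n n \<and> symmetric_mat B \<and> sublist xs (sepr B)))
         \<longleftrightarrow> xs \<in> {[Astar, N], [N, Astar], [N, Sstar], [Sstar, N]}"
proof -
  obtain x y where xs: "xs = [x, y]"
    using assms by (auto simp: length_Suc_conv numeral_2_eq_2)
  have "xs \<notin> {[Astar, N], [N, Astar], [N, Sstar], [Sstar, N]}"
    if B: "B \<in> carrier_mat n n" "symmetric_mat B" and occurs: "sublist xs (sepr B)" for n and B :: "real mat"
  proof
    assume forbidden: "xs \<in> {[Astar, N], [N, Astar], [N, Sstar], [Sstar, N]}"
    obtain k where k: "Suc (Suc k) \<le> n" "sepr_term B (Suc k) = x" "sepr_term B (Suc (Suc k)) = y"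
      using sublist_pair_sepr[OF occurs[unfolded xs]] B(1) by auto
    consider "x = N" "y \<in> {Astar, Sstar}" | "y = N" "x \<in> {Astar, Sstar}"
      using forbidden xs by auto
    then show False
    proof cases
      case 1
      then show False
        using not_both_signs_next_to_N[OF B, of k "Suc (Suc k)"] star_term_has_both_signs[of B "Suc (Suc k)"] k B(1)
        by auto
    next
      case 2
      then show False
        using not_both_signs_next_to_N[OF B, of "Suc k" "Suc k"] star_term_has_both_signs[of B "Suc k"] k B(1)
        by auto
    qed
  qed
  moreover have "\<exists>(n::nat) (B::real mat). n \<ge> 1 \<and> B \<in> carrier_mat n n \<and> symmetric_mat B \<and> sublist xs (sepr B)"
    if "xs \<notin> {[Astar, N], [N, Astar], [N, Sstar], [Sstar, N]}"
    using attained_pair that unfolding xs by blast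
  ultimately show ?thesis by blast
qed

end
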